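(* Let $C\subset \mathbb{R}^n$ be a nonempty closed convex set with nonempty interior. Fix $x\in \mathbb{R}^n$. Then, for every $\delta>0$, $$ \|p_{\delta}(x)-\operatorname{proj}_C(x)\|\le \sqrt{n\,\delta}. $$
   Context: $\mathbb{R}^n$ carries its Euclidean norm $\|\cdot\|$, and $\operatorname{proj}_C(x)$ is the metric projection of $x$ onto $C$ (the unique nearest point of $C$ to $x$). For $\delta>0$, $$ p_{\delta}(x):=\frac{\mathbb{E}_{y\sim \mathcal{N}(x,\delta I)}[y\, \mathbf{1}_C(y)]}{\mathbb{E}_{y\sim \mathcal{N}(x,\delta I)}[\mathbf{1}_C(y)]}=\mathbb{E}_{y\sim \mathcal{N}(x,\delta I)}[y\mid y\in C], $$ where $\mathcal{N}(x,\delta I)$ is the Gaussian distribution on $\mathbb{R}^n$ with mean $x$ and covariance $\delta I$, and $\mathbf{1}_C$ is the function equal to $1$ on $C$ and $0$ off $C$. *)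

theory Defs
  imports "HOL-Probability.Probability"
begin

text \<open>
  The isotropic Gaussian distribution with mean \<open>x\<close> and covariance \<open>\<delta> I\<close> on Euclidean space.
  The parameter \<open>\<delta>\<close> is the variance of each coordinate, whereas the library's
  \<^const>\<open>normal_density\<close> takes the standard deviation; the definition is meaningful only for \<open>\<delta> > 0\<close>.
\<close>

definition gaussian :: "real ^ 'n \<Rightarrow> real \<Rightarrow> (real ^ 'n) measure" where
  "gaussian x \<delta> = density lborel
     (\<lambda>y. ennreal (exp (- (norm (y - x))\<^sup>2 / (2 * \<delta>)) / sqrt (2 * pi * \<delta>) ^ CARD('n)))"

lemma gaussian_eq_prod_normal_density:
  fixes x :: "real ^ 'n"
  assumes "\<delta> > 0"
  shows "gaussian x \<delta> =
    density lborel (\<lambda>y. ennreal (\<Prod>i\<in>UNIV. normal_density (x $ i) (sqrt \<delta>) (y $ i)))"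
proof -
  have "(\<Prod>i\<in>UNIV. normal_density (x $ i) (sqrt \<delta>) (y $ i)) =
      exp (- (norm (y - x))\<^sup>2 / (2 * \<delta>)) / sqrt (2 * pi * \<delta>) ^ CARD('n)" for y
  proof -
    have "(\<Prod>i\<in>UNIV. normal_density (x $ i) (sqrt \<delta>) (y $ i)) =
        (\<Prod>i\<in>(UNIV::'n set). exp (- (y $ i - x $ i)\<^sup>2 / (2 * \<delta>)) / sqrt (2 * pi * \<delta>))"
      using assms by (simp add: normal_density_def)
    also have "\<dots> = exp (\<Sum>i\<in>(UNIV::'n set). - (y $ i - x $ i)\<^sup>2 / (2 * \<delta>))
        / sqrt (2 * pi * \<delta>) ^ CARD('n)"
      by (simp only: prod_dividef exp_sum[OF finite] prod_constant)
    also have "(\<Sum>i\<in>(UNIV::'n set). - (y $ i - x $ i)\<^sup>2 / (2 * \<delta>)) =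
        - (norm (y - x))\<^sup>2 / (2 * \<delta>)"
      by (simp add: norm_vec_def L2_set_def sum_nonneg sum_negf sum_divide_distrib)
    finally show ?thesis .
  qed
  then show ?thesis by (simp add: gaussian_def)
qed

definition gaussian_cond_mean :: "(real ^ 'n) set \<Rightarrow> real \<Rightarrow> real ^ 'n \<Rightarrow> real ^ 'n" where
  "gaussian_cond_mean C \<delta> x =
     (\<integral>y. indicat_real C y *\<^sub>R y \<partial>gaussian x \<delta>) /\<^sub>R (\<integral>y. indicat_real C y \<partial>gaussian x \<delta>)"

end

theory Submission
  imports Defs
begin

text \<open>
  Let \<open>q\<close> be the projection of \<open>x\<close> onto \<open>C\<close> and \<open>\<gamma>\<close> the Gaussian measure.
  For \<open>0 < t < 1\<close> the contraction \<open>y \<mapsto> q + t (y - q)\<close> maps \<open>C\<close> into itself, so a change of variables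
  bounds \<open>t ^ n\<close> times the integral over \<open>C\<close> of the contracted Gaussian density by \<open>\<gamma> C\<close>.
  Since \<open>(y - q) \<bullet> (q - x) \<ge> 0\<close> on \<open>C\<close>, contracting multiplies the density by at least
  \<open>1 + (1 - t\<^sup>2) \<parallel>y - q\<parallel>\<^sup>2 / (2 \<delta>)\<close>. Letting \<open>t \<rightarrow> 1\<close> gives
  \<open>E[\<parallel>y - q\<parallel>\<^sup>2 | y \<in> C] \<le> n \<delta>\<close>, and the claim follows from Jensen's inequality.
\<close>

lemma sets_gaussian [measurable_cong, simp]: "sets (gaussian x \<delta>) = sets borel"
  by (simp add: gaussian_def)

lemma space_gaussian [simp]: "space (gaussian x \<delta>) = UNIV"
  by (simp add: gaussian_def)

text \<open>The density factorises over the coordinates, so by Tonelli the total mass is a product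
  of one-dimensional normal masses, each equal to 1.\<close>

lemma prob_space_gaussian:
  fixes x :: "real ^ 'n"
  assumes "\<delta> > 0"
  shows "prob_space (gaussian x \<delta>)"
proof
  have normal: "(\<integral>\<^sup>+u. ennreal (normal_density m (sqrt \<delta>) u) \<partial>lborel) = 1" for m
  proof -
    interpret prob_space "density lborel (\<lambda>u. ennreal (normal_density m (sqrt \<delta>) u))"
      using assms by (intro prob_space_normal_density) simp
    show ?thesis using emeasure_space_1 by (simp add: emeasure_density)
  qed
  have inj: "inj (\<lambda>i::'n. axis i (1::real))"
    by (simp add: inj_on_def axis_eq_axis)
  \<comment> \<open>\<open>nn_integral_lborel_prod\<close> takes its product over
    \<open>Basis\<close>, whereas the density is a product over coordinate indices; the injection
    \<open>axis\<close> translates between the two.\<close>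
  have prod_Basis: "(\<Prod>b\<in>(Basis :: (real ^ 'n) set). g b) = (\<Prod>i\<in>UNIV. g (axis i 1))"
    for g :: "real ^ 'n \<Rightarrow> ennreal"
  proof -
    have Basis: "(Basis :: (real ^ 'n) set) = range (\<lambda>i. axis i 1)"
      by (auto simp: Basis_vec_def)
    show ?thesis unfolding Basis by (subst prod.reindex[OF inj]) (simp add: o_def)
  qed
  have "emeasure (gaussian x \<delta>) (space (gaussian x \<delta>)) =
      (\<integral>\<^sup>+y. (\<Prod>i\<in>UNIV. ennreal (normal_density (x $ i) (sqrt \<delta>) (y $ i))) \<partial>lborel)"
    by (simp add: gaussian_eq_prod_normal_density[OF assms] emeasure_density prod_ennreal)
  also have "\<dots> = (\<integral>\<^sup>+y. (\<Prod>b\<in>Basis. ennreal (normal_density (x \<bullet> b) (sqrt \<delta>) (y \<bullet> b))) \<partial>lborel)"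
    by (simp add: prod_Basis inner_axis)
  also have "\<dots> = (\<Prod>b\<in>(Basis :: (real ^ 'n) set).
      \<integral>\<^sup>+u. ennreal (normal_density (x \<bullet> b) (sqrt \<delta>) u) \<partial>lborel)"
    by (rule nn_integral_lborel_prod[of "\<lambda>b u. ennreal (normal_density (x \<bullet> b) (sqrt \<delta>) u)"]) auto
  also have "\<dots> = 1" by (simp add: normal)
  finally show "emeasure (gaussian x \<delta>) (space (gaussian x \<delta>)) = 1" .
qed

text \<open>The density vanishes nowhere, so a set of Gaussian measure zero is Lebesgue null and has
  empty interior. Positivity makes the quotient defining the conditional mean a genuine one.\<close>

lemma measure_gaussian_pos:
  fixes x :: "real ^ 'n"
  assumes "\<delta> > 0" "C \<in> sets borel" "interior C \<noteq> {}"
  shows "measure (gaussian x \<delta>) C > 0"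
proof -
  interpret prob_space "gaussian x \<delta>" by (rule prob_space_gaussian[OF assms(1)])
  have "emeasure (gaussian x \<delta>) C \<noteq> 0"
  proof
    assume "emeasure (gaussian x \<delta>) C = 0"
    then have "AE y in lborel. exp (- ((norm (y - x))\<^sup>2 / (2 * \<delta>))) / sqrt (2 * pi * \<delta>) ^ CARD('n) \<le> 0 \<or> y \<notin> C"
      using assms(1,2)
      by (simp add: gaussian_def emeasure_density nn_integral_0_iff_AE indicator_eq_0_iff
          ennreal_eq_0_iff)
    moreover have "sqrt (2 * pi * \<delta>) ^ CARD('n) > 0" using assms(1) by simp
    ultimately have "AE y in lborel. y \<notin> C"
      by (elim eventually_mono) (simp add: divide_le_0_iff not_le)
    then have "C \<in> null_sets lborel"
      using assms(2) by (subst AE_iff_null_sets) auto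
    then have "negligible C"
      by (simp add: negligible_iff_null_sets null_sets_completionI)
    then show False
      using assms(3) open_not_negligible[of "interior C"] negligible_subset interior_subset by blast
  qed
  then show ?thesis
    by (simp add: emeasure_eq_measure less_le)
qed

lemma closest_point_inner_nonneg:
  assumes "convex C" "closed C" "y \<in> C"
  shows "(y - closest_point C x) \<bullet> (closest_point C x - x) \<ge> 0"
  using closest_point_dot[OF assms, of x] by (simp add: inner_diff_left inner_diff_right inner_commute)

text \<open>With \<open>u = y - q\<close> and \<open>w = q - x\<close>, the norm squared of
  \<open>u + w\<close> exceeds that of \<open>t u + w\<close> by exactly
  \<open>(1 - t^2) |u|^2 + 2 (1 - t) (u \<bullet> w)\<close>, and the second term is
  nonnegative.\<close>

lemma norm_contraction_power2_le:
  fixes y q x :: "'a :: real_inner"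
  assumes "t \<le> 1" "(y - q) \<bullet> (q - x) \<ge> 0"
  shows "(norm (((1 - t) *\<^sub>R q + t *\<^sub>R y) - x))\<^sup>2 \<le> (norm (y - x))\<^sup>2 - (1 - t\<^sup>2) * (norm (y - q))\<^sup>2"
proof -
  define u w where "u = y - q" and "w = q - x"
  have eqs: "((1 - t) *\<^sub>R q + t *\<^sub>R y) - x = t *\<^sub>R u + w" "y - x = u + w"
    by (simp_all add: u_def w_def algebra_simps)
  have "t * (u \<bullet> w) \<le> u \<bullet> w"
    using assms mult_right_mono[of t 1 "u \<bullet> w"] by (simp add: u_def w_def)
  then show ?thesis
    unfolding eqs u_def[symmetric]
    unfolding power2_norm_eq_inner
    by (simp add: inner_add_left inner_add_right inner_commute power2_eq_square algebra_simps)
qed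

lemma nn_integral_lborel_scaled:
  fixes a :: "'a :: euclidean_space"
  assumes [measurable]: "g \<in> borel_measurable borel" and "t > 0"
  shows "(\<integral>\<^sup>+y. g y \<partial>lborel) = ennreal (t ^ DIM('a)) * (\<integral>\<^sup>+y. g (a + t *\<^sub>R y) \<partial>lborel)"
  using assms(2)
  by (subst lborel_affine[of t a])
    (simp_all add: nn_integral_density nn_integral_distr nn_integral_cmult)

text \<open>Substituting \<open>(1 - t) q + t y\<close> turns the mass of \<open>C\<close> into
  \<open>t^n\<close> times an integral over all \<open>y\<close> whose contraction lies in
  \<open>C\<close>. By convexity these include \<open>C\<close> itself, where the density at the
  contracted point is bounded below.\<close>

lemma gaussian_contraction_le:
  fixes C :: "(real ^ 'n) set"
  assumes "C \<in> sets borel" "convex C" "q \<in> C"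
    and obtuse: "\<And>y. y \<in> C \<Longrightarrow> (y - q) \<bullet> (q - x) \<ge> 0"
    and "\<delta> > 0" "0 < t" "t \<le> 1"
  shows "ennreal (t ^ CARD('n)) * (\<integral>\<^sup>+y. ennreal (1 + (1 - t\<^sup>2) * (norm (y - q))\<^sup>2 / (2 * \<delta>)) * indicator C y
      \<partial>gaussian x \<delta>) \<le> emeasure (gaussian x \<delta>) C"
proof -
  note [measurable] = assms(1)
  define f where "f y = exp (- (norm (y - x))\<^sup>2 / (2 * \<delta>)) / sqrt (2 * pi * \<delta>) ^ CARD('n)" for y
  have [measurable]: "f \<in> borel_measurable borel" unfolding f_def by measurable
  have f_nonneg: "f y \<ge> 0" for y using assms by (simp add: f_def)
  have gauss: "gaussian x \<delta> = density lborel (\<lambda>y. ennreal (f y))"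
    by (simp add: gaussian_def f_def)
  have ratio: "f y * (1 + (1 - t\<^sup>2) * (norm (y - q))\<^sup>2 / (2 * \<delta>)) \<le> f ((1 - t) *\<^sub>R q + t *\<^sub>R y)"
    if "y \<in> C" for y
  proof -
    let ?s = "(1 - t\<^sup>2) * (norm (y - q))\<^sup>2 / (2 * \<delta>)"
    \<comment> \<open>Weakening the gain \<open>exp ?s\<close> to \<open>1 + ?s\<close> leaves just
      the second moment, and loses nothing to first order as t tends to 1.\<close>
    have "exp (- (norm (y - x))\<^sup>2 / (2 * \<delta>)) * (1 + ?s)
        \<le> exp (- (norm (y - x))\<^sup>2 / (2 * \<delta>)) * exp ?s"
      by (intro mult_left_mono exp_ge_add_one_self) simp
    also have "\<dots> = exp (- ((norm (y - x))\<^sup>2 - (1 - t\<^sup>2) * (norm (y - q))\<^sup>2) / (2 * \<delta>))"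
      unfolding exp_add[symmetric] by (simp add: diff_divide_distrib)
    also have "\<dots> \<le> exp (- (norm (((1 - t) *\<^sub>R q + t *\<^sub>R y) - x))\<^sup>2 / (2 * \<delta>))"
      unfolding exp_le_cancel_iff using assms(5) norm_contraction_power2_le[OF assms(7) obtuse[OF that]]
      by (intro divide_right_mono) auto
    finally show ?thesis
      unfolding f_def times_divide_eq_left by (rule divide_right_mono) (use assms(5) in simp)
  qed
  have mem: "(1 - t) *\<^sub>R q + t *\<^sub>R y \<in> C" if "y \<in> C" for y
    using assms that by (intro convexD) auto
  have "(\<integral>\<^sup>+y. ennreal (1 + (1 - t\<^sup>2) * (norm (y - q))\<^sup>2 / (2 * \<delta>)) * indicator C y \<partial>gaussian x \<delta>)
      = (\<integral>\<^sup>+y. ennreal (f y) * (ennreal (1 + (1 - t\<^sup>2) * (norm (y - q))\<^sup>2 / (2 * \<delta>)) * indicator C y) \<partial>lborel)"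
    unfolding gauss by (rule nn_integral_density) measurable
  also have "\<dots> \<le> (\<integral>\<^sup>+y. ennreal (f ((1 - t) *\<^sub>R q + t *\<^sub>R y)) * indicator C ((1 - t) *\<^sub>R q + t *\<^sub>R y) \<partial>lborel)"
    by (intro nn_integral_mono)
      (auto simp: mem f_nonneg ennreal_mult'[symmetric] intro!: ennreal_leI ratio split: split_indicator)
  finally have "ennreal (t ^ CARD('n)) * (\<integral>\<^sup>+y. ennreal (1 + (1 - t\<^sup>2) * (norm (y - q))\<^sup>2 / (2 * \<delta>)) * indicator C y
      \<partial>gaussian x \<delta>) \<le> ennreal (t ^ CARD('n)) *
        (\<integral>\<^sup>+y. ennreal (f ((1 - t) *\<^sub>R q + t *\<^sub>R y)) * indicator C ((1 - t) *\<^sub>R q + t *\<^sub>R y) \<partial>lborel)"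
    by (rule mult_left_mono) simp
  also have "\<dots> = (\<integral>\<^sup>+y. ennreal (f y) * indicator C y \<partial>lborel)"
    using nn_integral_lborel_scaled[of "\<lambda>y. ennreal (f y) * indicator C y" t "(1 - t) *\<^sub>R q"] assms(6)
    by simp
  also have "\<dots> = emeasure (gaussian x \<delta>) C"
    unfolding gauss by (simp add: emeasure_density)
  finally show ?thesis .
qed

text \<open>The contraction inequality is an equality at \<open>t = 1\<close>, so its first-order
  part as t increases to 1 carries the information: it compares the second moment with the
  derivative n of \<open>t^n\<close>.\<close>

lemma gaussian_restricted_second_moment:
  fixes C :: "(real ^ 'n) set"
  assumes "C \<in> sets borel" "convex C" "q \<in> C"
    and "\<And>y. y \<in> C \<Longrightarrow> (y - q) \<bullet> (q - x) \<ge> 0" and "\<delta> > 0"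
  shows "integrable (gaussian x \<delta>) (\<lambda>y. indicat_real C y * (norm (y - q))\<^sup>2)" (is ?int)
    and "(\<integral>y. indicat_real C y * (norm (y - q))\<^sup>2 \<partial>gaussian x \<delta>)
      \<le> real CARD('n) * \<delta> * measure (gaussian x \<delta>) C" (is "?S \<le> _ * ?Z")
proof -
  note [measurable] = assms(1)
  interpret prob_space "gaussian x \<delta>" by (rule prob_space_gaussian[OF assms(5)])
  let ?n = "CARD('n)"
  let ?h = "\<lambda>t y. indicat_real C y + (1 - t\<^sup>2) / (2 * \<delta>) * (indicat_real C y * (norm (y - q))\<^sup>2)"
  have bound: "ennreal (t ^ ?n) * (\<integral>\<^sup>+y. ennreal (?h t y) \<partial>gaussian x \<delta>) \<le> ennreal ?Z"
    if "0 < t" "t \<le> 1" for t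
  proof -
    have "(\<integral>\<^sup>+y. ennreal (?h t y) \<partial>gaussian x \<delta>) =
        (\<integral>\<^sup>+y. ennreal (1 + (1 - t\<^sup>2) * (norm (y - q))\<^sup>2 / (2 * \<delta>)) * indicator C y \<partial>gaussian x \<delta>)"
      by (intro nn_integral_cong) (auto split: split_indicator)
    then show ?thesis
      using gaussian_contraction_le[OF assms that] by (simp add: emeasure_eq_measure)
  qed
  have h_nonneg: "?h t y \<ge> 0" if "0 < t" "t \<le> 1" for t y
    using that assms(5) power_le_one[of t 2] by simp
  have ind: "integrable (gaussian x \<delta>) (indicat_real C)"
    by (simp add: less_top[symmetric])
  \<comment> \<open>Integrability needs a single t with \<open>1 - t^2 > 0\<close>; here
    \<open>t = 1/2\<close>. Subtracting the indicator from \<open>?h (1/2)\<close> and rescaling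
    isolates the second-moment term.\<close>
  have "ennreal ((1/2) ^ ?n) * (\<integral>\<^sup>+y. ennreal (?h (1/2) y) \<partial>gaussian x \<delta>) < \<infinity>"
    using bound[of "1/2"] by (simp add: le_less_trans)
  then have "(\<integral>\<^sup>+y. ennreal (?h (1/2) y) \<partial>gaussian x \<delta>) < \<infinity>"
    by (auto simp: ennreal_mult_less_top)
  then have "integrable (gaussian x \<delta>) (?h (1/2))"
    using h_nonneg[of "1/2"] by (intro integrableI_nonneg) auto
  then have "integrable (gaussian x \<delta>)
      (\<lambda>y. (?h (1/2) y - indicat_real C y) * (2 * \<delta> / (1 - (1/2)\<^sup>2)))"
    using ind by (intro integrable_mult_left Bochner_Integration.integrable_diff) auto
  then show int: ?int
    using assms(5) by (simp add: field_simps power2_eq_square)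
  have ineq: "t ^ ?n * (1 + t) * ?S \<le> 2 * real ?n * \<delta> * ?Z" if t: "0 < t" "t < 1" for t
  proof -
    have "(\<integral>\<^sup>+y. ennreal (?h t y) \<partial>gaussian x \<delta>) = ennreal (\<integral>y. ?h t y \<partial>gaussian x \<delta>)"
      using h_nonneg[of t] t int ind by (intro nn_integral_eq_integral) auto
    also have "(\<integral>y. ?h t y \<partial>gaussian x \<delta>) = ?Z + (1 - t\<^sup>2) / (2 * \<delta>) * ?S"
      using int ind by simp
    finally have "t ^ ?n * (?Z + (1 - t\<^sup>2) / (2 * \<delta>) * ?S) \<le> ?Z"
      using bound[of t] t by (simp add: ennreal_mult'[symmetric])
    then have "t ^ ?n * ((1 - t\<^sup>2) / (2 * \<delta>) * ?S) \<le> (1 - t ^ ?n) * ?Z"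
      by (simp add: algebra_simps)
    \<comment> \<open>Bernoulli's inequality at \<open>t - 1\<close> exposes a factor
      \<open>1 - t\<close> on the right, matching the one in
      \<open>1 - t^2 = (1 - t) (1 + t)\<close>. Once it is cancelled, the bound stays meaningful at
      \<open>t = 1\<close>.\<close>
    also have "\<dots> \<le> real ?n * (1 - t) * ?Z"
      using Bernoulli_inequality[of "t - 1" ?n] t by (intro mult_right_mono) (auto simp: algebra_simps)
    finally have "(1 - t) * (t ^ ?n * (1 + t) * ?S) \<le> (1 - t) * (2 * real ?n * \<delta> * ?Z)"
      using assms(5) by (simp add: field_simps power2_eq_square)
    then show ?thesis using t by simp
  qed
  have "((\<lambda>t::real. t ^ ?n * (1 + t) * ?S) \<longlongrightarrow> 1 ^ ?n * (1 + 1) * ?S) (at_left 1)"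
    by (intro tendsto_intros)
  moreover have "\<forall>\<^sub>F t in at_left (1::real). t ^ ?n * (1 + t) * ?S \<le> 2 * real ?n * \<delta> * ?Z"
    using eventually_at_left_real[of 0 1] by (rule eventually_mono[OF _]) (auto intro: ineq)
  ultimately have "1 ^ ?n * (1 + 1) * ?S \<le> 2 * real ?n * \<delta> * ?Z"
    by (intro tendsto_upperbound) auto
  then show "?S \<le> real ?n * \<delta> * ?Z" by simp
qed

text \<open>This is Jensen's inequality for the squared norm under \<open>M\<close> conditioned on
  \<open>C\<close>, multiplied through by \<open>measure M C\<close>. The proof pairs the mean
  deviation \<open>v\<close> with itself and applies
  \<open>2 (a \<bullet> v) \<le> |a|^2 + |v|^2\<close> under the integral.\<close>

lemma norm_cond_mean_diff_power2_le:
  fixes q :: "'a :: euclidean_space"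
  assumes "finite_measure M" and [measurable_cong]: "sets M = sets borel" and [measurable]: "C \<in> sets borel"
    and int: "integrable M (\<lambda>y. indicat_real C y * (norm (y - q))\<^sup>2)"
    and pos: "measure M C > 0"
  shows "measure M C * (norm ((\<integral>y. indicat_real C y *\<^sub>R y \<partial>M) /\<^sub>R measure M C - q))\<^sup>2
    \<le> (\<integral>y. indicat_real C y * (norm (y - q))\<^sup>2 \<partial>M)"
proof -
  interpret finite_measure M by fact
  have [measurable]: "C \<in> sets M" using assms by simp
  define v where "v = (\<integral>y. indicat_real C y *\<^sub>R y \<partial>M) /\<^sub>R measure M C - q"
  have ind: "integrable M (indicat_real C)"
    by (simp add: less_top[symmetric])
  have int1: "integrable M (\<lambda>y. indicat_real C y *\<^sub>R (y - q))"
  proof (rule Bochner_Integration.integrable_bound)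
    show "integrable M (\<lambda>y. indicat_real C y + indicat_real C y * (norm (y - q))\<^sup>2)"
      using ind int by simp
    have "r \<le> 1 + r\<^sup>2" for r :: real
      using zero_le_power2[of "r - 1"] zero_le_power2[of r]
      unfolding power2_diff power_one mult_1_right by linarith
    then show "AE y in M. norm (indicat_real C y *\<^sub>R (y - q))
        \<le> norm (indicat_real C y + indicat_real C y * (norm (y - q))\<^sup>2)"
      by (auto split: split_indicator)
  qed measurable
  \<comment> \<open>Adding \<open>q\<close> back on \<open>C\<close> shows that
    \<open>indicat_real C y *\<^sub>R y\<close> is integrable, which splitting the integral below
    requires.\<close>
  have "integrable M (\<lambda>y. indicat_real C y *\<^sub>R (y - q) + indicat_real C y *\<^sub>R q)"
    using int1 ind by (intro Bochner_Integration.integrable_add integrable_scaleR_left) auto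
  then have "(\<integral>y. indicat_real C y *\<^sub>R (y - q) \<partial>M)
      = (\<integral>y. indicat_real C y *\<^sub>R y \<partial>M) - (\<integral>y. indicat_real C y *\<^sub>R q \<partial>M)"
    using ind by (simp add: scaleR_diff_right)
  also have "\<dots> = measure M C *\<^sub>R v"
    using pos ind by (simp add: v_def scaleR_diff_right)
  finally have mean: "(\<integral>y. indicat_real C y *\<^sub>R (y - q) \<partial>M) = measure M C *\<^sub>R v" .
  have "measure M C * (norm v)\<^sup>2 = (\<integral>y. indicat_real C y *\<^sub>R (y - q) \<partial>M) \<bullet> v"
    by (simp add: mean power2_norm_eq_inner)
  also have "\<dots> = (\<integral>y. (indicat_real C y *\<^sub>R (y - q)) \<bullet> v \<partial>M)"
    by (rule integral_inner_left[OF int1, symmetric])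
  also have "\<dots> \<le> (\<integral>y. (indicat_real C y * (norm (y - q))\<^sup>2 + indicat_real C y * (norm v)\<^sup>2) / 2 \<partial>M)"
  proof (rule integral_mono)
    have "a \<bullet> v \<le> ((norm a)\<^sup>2 + (norm v)\<^sup>2) / 2" for a
      using inner_ge_zero[of "a - v"]
      by (simp add: power2_norm_eq_inner inner_diff_left inner_diff_right inner_commute)
    then show "(indicat_real C y *\<^sub>R (y - q)) \<bullet> v
        \<le> (indicat_real C y * (norm (y - q))\<^sup>2 + indicat_real C y * (norm v)\<^sup>2) / 2" for y
      by (auto split: split_indicator)
  qed (use integrable_inner_left[OF int1, of v] ind int in auto)
  \<comment> \<open>Half of \<open>measure M C * (norm v)\<^sup>2\<close> now stands on the right
    and is absorbed by the left-hand side.\<close>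
  also have "\<dots> = ((\<integral>y. indicat_real C y * (norm (y - q))\<^sup>2 \<partial>M) + measure M C * (norm v)\<^sup>2) / 2"
    using ind int by simp
  finally show ?thesis by (simp add: v_def)
qed

theorem corollary3p3:
  fixes C :: "(real ^ 'n) set" and x :: "real ^ 'n" and \<delta> :: real
  assumes "C \<noteq> {}" and "closed C" and "convex C" and "interior C \<noteq> {}"
    and "\<delta> > 0"
  shows "norm (gaussian_cond_mean C \<delta> x - closest_point C x) \<le> sqrt (real CARD('n) * \<delta>)"
proof -
  interpret prob_space "gaussian x \<delta>" by (rule prob_space_gaussian[OF assms(5)])
  define q where "q = closest_point C x"
  have meas: "C \<in> sets borel" using assms(2) by simp
  have q: "q \<in> C" unfolding q_def by (rule closest_point_in_set[OF assms(2,1)])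
  have obtuse: "(y - q) \<bullet> (q - x) \<ge> 0" if "y \<in> C" for y
    unfolding q_def using assms that by (intro closest_point_inner_nonneg)
  have pos: "measure (gaussian x \<delta>) C > 0"
    by (rule measure_gaussian_pos[OF assms(5) meas assms(4)])
  note moment = gaussian_restricted_second_moment[OF meas assms(3) q obtuse assms(5)]
  have "gaussian_cond_mean C \<delta> x
      = (\<integral>y. indicat_real C y *\<^sub>R y \<partial>gaussian x \<delta>) /\<^sub>R measure (gaussian x \<delta>) C"
    using meas by (simp add: gaussian_cond_mean_def)
  then have "measure (gaussian x \<delta>) C * (norm (gaussian_cond_mean C \<delta> x - q))\<^sup>2
      \<le> measure (gaussian x \<delta>) C * (real CARD('n) * \<delta>)"
    using norm_cond_mean_diff_power2_le[OF finite_measure_axioms _ meas moment(1) pos] moment(2)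
    by (simp add: mult.commute)
  then have "(norm (gaussian_cond_mean C \<delta> x - q))\<^sup>2 \<le> real CARD('n) * \<delta>"
    using pos by simp
  then show ?thesis unfolding q_def by (rule real_le_rsqrt)
qed

end
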